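(* For each integer $n\geq 0$, let $f_n$ denote the number of isomorphism classes of matroids on a set of size $n$. Then $f_{n+m}\geq f_n\cdot f_m$ for all integers $n,m\geq 0$.
   Context: Two matroids are isomorphic if there is a bijection between their ground sets carrying independent sets exactly to independent sets. *)

theory Defs
  imports Main
begin

locale matroid =
  fixes E :: "'a set" and \<I> :: "'a set set"
  assumes finite_ground: "finite E"
    and indep_subset_ground: "X \<in> \<I> \<Longrightarrow> X \<subseteq> E"
    and indep_empty: "{} \<in> \<I>"
    and indep_hereditary: "X \<in> \<I> \<Longrightarrow> Y \<subseteq> X \<Longrightarrow> Y \<in> \<I>"
    and indep_augment:
      "X \<in> \<I> \<Longrightarrow> Y \<in> \<I> \<Longrightarrow> card X < card Y \<Longrightarrow> \<exists>y \<in> Y - X. insert y X \<in> \<I>"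

definition matroid_iso :: "'a set \<Rightarrow> 'a set set \<Rightarrow> 'b set \<Rightarrow> 'b set set \<Rightarrow> bool" where
  "matroid_iso E \<I> F \<J> \<longleftrightarrow>
    (\<exists>f. bij_betw f E F \<and> (\<forall>X \<subseteq> E. X \<in> \<I> \<longleftrightarrow> f ` X \<in> \<J>))"

definition matroids_on :: "'a set \<Rightarrow> 'a set set set" where
  "matroids_on E = {\<I>. matroid E \<I>}"

definition iso_rel :: "'a set \<Rightarrow> ('a set set \<times> 'a set set) set" where
  "iso_rel E = {(\<I>, \<J>). \<I> \<in> matroids_on E \<and> \<J> \<in> matroids_on E \<and> matroid_iso E \<I> E \<J>}"

definition iso_classes_on :: "'a set \<Rightarrow> 'a set set set set" where
  "iso_classes_on E = matroids_on E // iso_rel E"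

text \<open>The canonical ground set of size \<open>n\<close> is \<open>{..<n}\<close>; by \<open>card_iso_classes_on\<close> below every
  other ground set of size \<open>n\<close>, of any type, gives the same number.\<close>

definition num_matroids :: "nat \<Rightarrow> nat" where
  "num_matroids n = card (iso_classes_on {..<n})"

lemma matroid_iso_refl: "matroid_iso E \<I> E \<I>"
  unfolding matroid_iso_def by (rule exI[of _ "\<lambda>x. x"]) (auto simp: bij_betw_def)

lemma matroid_iso_sym:
  assumes "matroid_iso E \<I> F \<J>"
  shows "matroid_iso F \<J> E \<I>"
proof -
  obtain f where f: "bij_betw f E F" and i: "\<And>X. X \<subseteq> E \<Longrightarrow> X \<in> \<I> \<longleftrightarrow> f ` X \<in> \<J>"
    using assms unfolding matroid_iso_def by blast
  let ?g = "inv_into E f"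
  have g: "bij_betw ?g F E" using f by (rule bij_betw_inv_into)
  have "Y \<in> \<J> \<longleftrightarrow> ?g ` Y \<in> \<I>" if "Y \<subseteq> F" for Y
  proof -
    have "?g ` Y \<subseteq> E" using g that unfolding bij_betw_def by blast
    moreover have "f ` ?g ` Y = Y"
      using f that by (simp add: bij_betw_def image_inv_into_cancel)
    ultimately show ?thesis using i[of "?g ` Y"] by simp
  qed
  with g show ?thesis unfolding matroid_iso_def by blast
qed

lemma matroid_iso_trans:
  assumes "matroid_iso E \<I> F \<J>" "matroid_iso F \<J> G \<K>"
  shows "matroid_iso E \<I> G \<K>"
proof -
  obtain f where f: "bij_betw f E F" "\<And>X. X \<subseteq> E \<Longrightarrow> X \<in> \<I> \<longleftrightarrow> f ` X \<in> \<J>"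
    using assms(1) unfolding matroid_iso_def by blast
  obtain g where g: "bij_betw g F G" "\<And>X. X \<subseteq> F \<Longrightarrow> X \<in> \<J> \<longleftrightarrow> g ` X \<in> \<K>"
    using assms(2) unfolding matroid_iso_def by blast
  have "X \<in> \<I> \<longleftrightarrow> (g \<circ> f) ` X \<in> \<K>" if "X \<subseteq> E" for X
  proof -
    have "f ` X \<subseteq> F" using f(1) that unfolding bij_betw_def by blast
    then show ?thesis using f(2)[OF that] g(2)[of "f ` X"] by (simp add: image_comp)
  qed
  with bij_betw_trans[OF f(1) g(1)] show ?thesis unfolding matroid_iso_def by blast
qed

lemma equiv_iso_rel: "equiv (matroids_on E) (iso_rel E)"
proof (rule equivI)
  show "sym (iso_rel E)" by (auto simp: iso_rel_def intro!: symI dest: matroid_iso_sym)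
  show "trans (iso_rel E)" by (auto simp: iso_rel_def intro!: transI dest: matroid_iso_trans)
qed (auto simp: iso_rel_def refl_on_def matroid_iso_refl)

lemma finite_matroids_on: "finite E \<Longrightarrow> finite (matroids_on E)"
  by (rule finite_subset[of _ "Pow (Pow E)"])
    (auto simp: matroids_on_def dest: matroid.indep_subset_ground)

lemma finite_iso_classes_on: "finite E \<Longrightarrow> finite (iso_classes_on E)"
  unfolding iso_classes_on_def
  by (rule finite_quotient[OF finite_matroids_on]) (auto simp: iso_rel_def)

lemma matroid_image:
  assumes f: "bij_betw f E F" and M: "matroid E \<I>"
  shows "matroid F ((`) f ` \<I>)"
proof -
  interpret matroid E \<I> by (fact M)
  have inj: "inj_on f E" and im: "f ` E = F" using f by (auto simp: bij_betw_def)
  show ?thesis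
  proof
    show "finite F" using finite_ground im by blast
    show "X \<subseteq> F" if "X \<in> (`) f ` \<I>" for X
      using that indep_subset_ground im by blast
    show "{} \<in> (`) f ` \<I>" using indep_empty by blast
    show "Y \<in> (`) f ` \<I>" if X: "X \<in> (`) f ` \<I>" and "Y \<subseteq> X" for X Y
    proof -
      obtain A where "A \<in> \<I>" "X = f ` A" using X by blast
      moreover obtain B where "B \<subseteq> A" "Y = f ` B"
        using \<open>Y \<subseteq> X\<close> \<open>X = f ` A\<close> by (meson subset_imageE)
      ultimately show ?thesis using indep_hereditary by blast
    qed
    show "\<exists>y \<in> Y - X. insert y X \<in> (`) f ` \<I>"
      if X: "X \<in> (`) f ` \<I>" and Y: "Y \<in> (`) f ` \<I>" and lt: "card X < card Y" for X Y
    proof -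
      obtain A where A: "A \<in> \<I>" "X = f ` A" using X by blast
      obtain B where B: "B \<in> \<I>" "Y = f ` B" using Y by blast
      have sub: "A \<subseteq> E" "B \<subseteq> E" using A B indep_subset_ground by auto
      have "card X = card A" "card Y = card B"
        using A B sub inj by (auto intro: card_image inj_on_subset)
      then obtain b where b: "b \<in> B - A" "insert b A \<in> \<I>"
        using indep_augment[OF A(1) B(1)] lt by auto
      have "f b \<in> Y - X" using b A B sub inj by (auto dest: inj_onD)
      moreover have "insert (f b) X \<in> (`) f ` \<I>" using b(2) A(2) by (metis image_eqI image_insert)
      ultimately show ?thesis by blast
    qed
  qed
qed

lemma matroid_iso_image:
  assumes f: "bij_betw f E F" and M: "matroid E \<I>"
  shows "matroid_iso E \<I> F ((`) f ` \<I>)"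
proof -
  have inj: "inj_on f E" using f by (simp add: bij_betw_def)
  have "X \<in> \<I> \<longleftrightarrow> f ` X \<in> (`) f ` \<I>" if "X \<subseteq> E" for X
  proof -
    have "X = A" if "A \<in> \<I>" "f ` X = f ` A" for A
      using that \<open>X \<subseteq> E\<close> matroid.indep_subset_ground[OF M] inj_on_image_eq_iff[OF inj] by simp
    then show ?thesis by (auto simp: image_iff)
  qed
  with f show ?thesis unfolding matroid_iso_def by blast
qed

lemma card_iso_classes_on_le:
  assumes f: "bij_betw f E F" and fin: "finite F"
  shows "card (iso_classes_on E) \<le> card (iso_classes_on F)"
proof (rule card_inj_on_le)
  let ?h = "\<lambda>C. iso_rel F `` ((`) ((`) f) ` C)"
  have img: "(`) f ` \<I> \<in> matroids_on F" if "\<I> \<in> matroids_on E" for \<I>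
    using that matroid_image[OF f] by (simp add: matroids_on_def)
  have isoI: "matroid_iso E \<I> F ((`) f ` \<I>)" if "\<I> \<in> matroids_on E" for \<I>
    using that matroid_iso_image[OF f] by (simp add: matroids_on_def)
  have transfer: "((`) f ` \<I>, (`) f ` \<J>) \<in> iso_rel F \<longleftrightarrow> (\<I>, \<J>) \<in> iso_rel E"
    if "\<I> \<in> matroids_on E" "\<J> \<in> matroids_on E" for \<I> \<J>
  proof -
    have "matroid_iso F ((`) f ` \<I>) F ((`) f ` \<J>) \<longleftrightarrow> matroid_iso E \<I> E \<J>"
      using isoI[OF that(1)] isoI[OF that(2)] matroid_iso_trans matroid_iso_sym by metis
    with that img show ?thesis by (simp add: iso_rel_def)
  qed
  have cls: "?h (iso_rel E `` {\<I>}) = iso_rel F `` {(`) f ` \<I>}" if I: "\<I> \<in> matroids_on E" for \<I>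
  proof -
    have "iso_rel F `` {(`) f ` \<J>} = iso_rel F `` {(`) f ` \<I>}" if "\<J> \<in> iso_rel E `` {\<I>}" for \<J>
    proof -
      from that have IJ: "(\<I>, \<J>) \<in> iso_rel E" by simp
      then have "\<J> \<in> matroids_on E" by (auto simp: iso_rel_def)
      with IJ I have "((`) f ` \<I>, (`) f ` \<J>) \<in> iso_rel F" by (simp add: transfer)
      then show ?thesis using equiv_class_eq[OF equiv_iso_rel] by metis
    qed
    moreover have "\<I> \<in> iso_rel E `` {\<I>}"
      using equiv_class_self[OF equiv_iso_rel I] .
    ultimately show ?thesis by blast
  qed
  show "inj_on ?h (iso_classes_on E)"
  proof (rule inj_onI)
    fix C D
    assume C: "C \<in> iso_classes_on E" and D: "D \<in> iso_classes_on E" and eq: "?h C = ?h D"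
    obtain \<I> where I: "\<I> \<in> matroids_on E" "C = iso_rel E `` {\<I>}"
      using C unfolding iso_classes_on_def by (rule quotientE)
    obtain \<J> where J: "\<J> \<in> matroids_on E" "D = iso_rel E `` {\<J>}"
      using D unfolding iso_classes_on_def by (rule quotientE)
    have "iso_rel F `` {(`) f ` \<I>} = iso_rel F `` {(`) f ` \<J>}"
      using eq cls[OF I(1)] cls[OF J(1)] I(2) J(2) by simp
    then have "((`) f ` \<I>, (`) f ` \<J>) \<in> iso_rel F"
      using eq_equiv_class[OF _ equiv_iso_rel img[OF J(1)]] by blast
    then have "(\<I>, \<J>) \<in> iso_rel E" using transfer I(1) J(1) by blast
    then show "C = D" using I(2) J(2) equiv_class_eq[OF equiv_iso_rel] by metis
  qed
  show "?h ` iso_classes_on E \<subseteq> iso_classes_on F"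
  proof
    fix D assume "D \<in> ?h ` iso_classes_on E"
    then obtain C where C: "C \<in> iso_classes_on E" "D = ?h C" by blast
    obtain \<I> where "\<I> \<in> matroids_on E" "C = iso_rel E `` {\<I>}"
      using C(1) unfolding iso_classes_on_def by (rule quotientE)
    then show "D \<in> iso_classes_on F"
      using C(2) cls img unfolding iso_classes_on_def by (metis quotientI)
  qed
  show "finite (iso_classes_on F)" using fin by (rule finite_iso_classes_on)
qed

lemma card_iso_classes_on:
  assumes "finite E"
  shows "card (iso_classes_on E) = num_matroids (card E)"
proof -
  obtain f where f: "bij_betw f E {..<card E}"
    using ex_bij_betw_finite_nat[OF assms] by (auto simp: atLeast0LessThan)
  show ?thesis
    unfolding num_matroids_def
    by (rule antisym)
      (use card_iso_classes_on_le[OF f] card_iso_classes_on_le[OF bij_betw_inv_into[OF f] assms]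
        in auto)
qed

end

theory Submission
  imports Defs "HOL-Combinatorics.Transposition"
begin

text \<open>Direct sums do not separate pairs of matroids, since \<open>M \<oplus> N\<close> and \<open>N \<oplus> M\<close> are isomorphic.
  Following Crapo and Schmitt, matroids \<open>M\<close> on \<open>S\<close> and \<open>N\<close> on \<open>T\<close> are combined into their free
  product on \<open>S \<union> T\<close>. Its restriction to \<open>S\<close> is \<open>M\<close>, its contraction by \<open>S\<close> is \<open>N\<close>, and an
  element of \<open>S\<close> in an independent set may be replaced by any element of \<open>T\<close>. If two sets \<open>S\<close> and
  \<open>U\<close> of the same size both have this exchange property, then every element of \<open>S - U\<close> is
  interchangeable with every element of \<open>U - S\<close>, so some automorphism takes \<open>S\<close> to \<open>U\<close>. Hence
  an isomorphism of free products can be chosen to preserve \<open>S\<close>, and then it induces isomorphisms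
  of both factors.\<close>

text \<open>The usual rank condition \<open>card A \<le> r(M) + r\<^sub>N(A \<inter> T)\<close>, with \<open>J\<close> as witness for the rank
  of \<open>A \<inter> T\<close> in \<open>N\<close>.\<close>

definition free_product ::
    "'a set \<Rightarrow> 'a set set \<Rightarrow> 'a set \<Rightarrow> 'a set set \<Rightarrow> 'a set set" where
  "free_product S \<I> T \<J> =
    {A. A \<subseteq> S \<union> T \<and> A \<inter> S \<in> \<I> \<and> (\<exists>J\<in>\<J>. J \<subseteq> A \<and> card (A - J) \<le> Max (card ` \<I>))}"

text \<open>The exchange is one-sided, out of \<open>S\<close> only; the reverse exchange comes from
  a second set with the same property. If \<open>b\<close> already lies in \<open>X\<close>, the
  conclusion is just \<open>X \<in> \<L>\<close>.\<close>

definition exchangeable :: "'a set \<Rightarrow> 'a set \<Rightarrow> 'a set set \<Rightarrow> bool" where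
  "exchangeable S E \<L> \<longleftrightarrow>
    (\<forall>X a b. insert a X \<in> \<L> \<longrightarrow> a \<in> S \<longrightarrow> a \<notin> X \<longrightarrow> b \<in> E - S \<longrightarrow> insert b X \<in> \<L>)"

section \<open>The free product is a matroid\<close>

lemma free_productI:
  "A \<subseteq> S \<union> T \<Longrightarrow> A \<inter> S \<in> \<I> \<Longrightarrow> J \<in> \<J> \<Longrightarrow> J \<subseteq> A \<Longrightarrow> card (A - J) \<le> Max (card ` \<I>)
    \<Longrightarrow> A \<in> free_product S \<I> T \<J>"
  unfolding free_product_def by blast

text \<open>Augmentation of \<open>A\<close> splits on slack, meaning a witness \<open>J\<close>
  with \<open>card (A - J)\<close> strictly below the rank of \<open>\<I>\<close>. With slack,
  \<open>J\<close> still serves after adding any element, so only the part in \<open>S\<close> must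
  stay independent. Without slack, the witness itself is augmented in \<open>\<J>\<close>.\<close>

lemma matroid_free_product:
  assumes M: "matroid S \<I>" and N: "matroid T \<J>" and disj: "S \<inter> T = {}"
  shows "matroid (S \<union> T) (free_product S \<I> T \<J>)"
proof -
  interpret M: matroid S \<I> by (fact M)
  interpret N: matroid T \<J> by (fact N)
  let ?r = "Max (card ` \<I>)"
  show ?thesis
  proof
    show fin: "finite (S \<union> T)" using M.finite_ground N.finite_ground by blast
    show "X \<subseteq> S \<union> T" if "X \<in> free_product S \<I> T \<J>" for X
      using that by (simp add: free_product_def)
    show "{} \<in> free_product S \<I> T \<J>"
      using M.indep_empty N.indep_empty by (auto simp: free_product_def)
    show "Y \<in> free_product S \<I> T \<J>" if X: "X \<in> free_product S \<I> T \<J>" and "Y \<subseteq> X" for X Y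
    proof -
      obtain J where J: "J \<in> \<J>" "card (X - J) \<le> ?r"
        and X': "X \<subseteq> S \<union> T" "X \<inter> S \<in> \<I>"
        using X by (auto simp: free_product_def)
      have "card (Y - (J \<inter> Y)) \<le> card (X - J)"
        using \<open>Y \<subseteq> X\<close> X'(1) fin by (intro card_mono) (auto intro: finite_subset)
      moreover have "J \<inter> Y \<in> \<J>" using J(1) N.indep_hereditary by blast
      moreover have "Y \<inter> S \<in> \<I>"
        using M.indep_hereditary[OF X'(2), of "Y \<inter> S"] \<open>Y \<subseteq> X\<close> by blast
      ultimately show ?thesis
        using J(2) X'(1) \<open>Y \<subseteq> X\<close> by (intro free_productI[of _ _ _ _ "J \<inter> Y"]) auto
    qed
    show "\<exists>y\<in>B - A. insert y A \<in> free_product S \<I> T \<J>"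
      if A: "A \<in> free_product S \<I> T \<J>" and B: "B \<in> free_product S \<I> T \<J>"
        and lt: "card A < card B" for A B
    proof -
      have A': "A \<subseteq> S \<union> T" "A \<inter> S \<in> \<I>" and B': "B \<subseteq> S \<union> T" "B \<inter> S \<in> \<I>"
        using A B by (auto simp: free_product_def)
      have finA: "finite A" and finB: "finite B" using A' B' fin by (auto intro: finite_subset)
      show ?thesis
      proof (cases "\<exists>J\<in>\<J>. J \<subseteq> A \<and> card (A - J) < ?r")
        case True
        then obtain J where J: "J \<in> \<J>" "J \<subseteq> A" "card (A - J) < ?r" by blast
        have le: "card (insert y A - J) \<le> ?r" for y
        proof -
          have "card (insert y A - J) \<le> card (insert y (A - J))"
            using finA by (intro card_mono) auto
          also have "\<dots> \<le> ?r" using J(3) by (intro card_insert_le_m1) auto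
          finally show ?thesis .
        qed
        \<comment> \<open>Elements of \<open>T\<close> leave the part in \<open>S\<close> unchanged.
          If \<open>B\<close> offers no new one, \<open>B\<close> must exceed \<open>A\<close>
          inside \<open>S\<close>, and \<open>\<I>\<close> can be augmented.\<close>
        have "\<exists>y\<in>B - A. insert y A \<inter> S \<in> \<I>"
        proof (cases "B \<inter> T \<subseteq> A")
          case True
          have split: "card X = card (X \<inter> S) + card (X \<inter> T)" if "X \<subseteq> S \<union> T" "finite X" for X
          proof -
            have "X = (X \<inter> S) \<union> (X \<inter> T)" using that by blast
            then show ?thesis
              using that disj card_Un_disjoint[of "X \<inter> S" "X \<inter> T"] by auto
          qed
          have "card (B \<inter> T) \<le> card (A \<inter> T)" using True finA by (intro card_mono) auto
          then have "card (A \<inter> S) < card (B \<inter> S)"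
            using lt split[OF A'(1) finA] split[OF B'(1) finB] by linarith
          then obtain y where "y \<in> B \<inter> S - A \<inter> S" "insert y (A \<inter> S) \<in> \<I>"
            using M.indep_augment[OF A'(2) B'(2)] by blast
          then show ?thesis by (intro bexI[of _ y]) auto
        next
          case False
          then obtain y where "y \<in> B" "y \<in> T" "y \<notin> A" by blast
          moreover from this have "insert y A \<inter> S = A \<inter> S" using disj by blast
          ultimately show ?thesis using A'(2) by (intro bexI[of _ y]) auto
        qed
        then obtain y where "y \<in> B - A" "insert y A \<inter> S \<in> \<I>" by blast
        then show ?thesis
          using J A'(1) B'(1) le by (intro bexI[of _ y] free_productI[of _ _ _ _ J]) auto
      next
        case False
        obtain J where J: "J \<in> \<J>" "J \<subseteq> A" "card (A - J) \<le> ?r"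
          using A by (auto simp: free_product_def)
        obtain K where K: "K \<in> \<J>" "K \<subseteq> B" "card (B - K) \<le> ?r"
          using B by (auto simp: free_product_def)
        \<comment> \<open>Without slack the bound for \<open>A\<close> is attained while
          \<open>card (B - K)\<close> is at most \<open>?r\<close>, so \<open>lt\<close> forces the
          witness \<open>K\<close> to be larger than \<open>J\<close>.\<close>
        have full: "card (A - J) = ?r" using False J by force
        have "card A = card (A - J) + card J" "card B = card (B - K) + card K"
          using J(2) K(2) finA finB
          by (metis add.commute card_Int_Diff inf.absorb2)+
        then have "card J < card K" using full K(3) lt by linarith
        then obtain y where y: "y \<in> K - J" "insert y J \<in> \<J>"
          using N.indep_augment[OF J(1) K(1)] by blast
        \<comment> \<open>If \<open>y\<close> were in \<open>A\<close>, then
          \<open>insert y J\<close> would be a witness with slack.\<close>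
        have "y \<notin> A"
        proof
          assume "y \<in> A"
          then have "A - insert y J \<subset> A - J" using y(1) by blast
          then have "card (A - insert y J) < ?r"
            using psubset_card_mono[of "A - J" "A - insert y J"] finA full by simp
          then show False using False y(2) J(2) \<open>y \<in> A\<close> by blast
        qed
        moreover have "y \<in> T" using y N.indep_subset_ground by blast
        moreover have "insert y A \<inter> S = A \<inter> S" using \<open>y \<in> T\<close> disj by blast
        moreover have "insert y A - insert y J = A - J" using \<open>y \<notin> A\<close> by blast
        ultimately show ?thesis
          using y J A' K(2)
          by (intro bexI[of _ y] free_productI[of _ _ _ _ "insert y J"]) auto
      qed
    qed
  qed
qed

section \<open>Exchange property and recovery of the factors\<close>

text \<open>The witness \<open>J\<close> lies in \<open>T\<close> and so misses \<open>a\<close>: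
  dropping \<open>a\<close> lowers \<open>card (A - J)\<close> by one, and adding \<open>b\<close>
  raises it by at most one.\<close>

lemma exchangeable_free_product:
  assumes M: "matroid S \<I>" and N: "matroid T \<J>" and disj: "S \<inter> T = {}"
  shows "exchangeable S (S \<union> T) (free_product S \<I> T \<J>)"
  unfolding exchangeable_def
proof (intro allI impI)
  fix X a b
  assume X: "insert a X \<in> free_product S \<I> T \<J>" and a: "a \<in> S" "a \<notin> X"
    and b: "b \<in> S \<union> T - S"
  obtain J where J: "J \<in> \<J>" "J \<subseteq> insert a X" "card (insert a X - J) \<le> Max (card ` \<I>)"
    and X': "insert a X \<subseteq> S \<union> T" "insert a X \<inter> S \<in> \<I>"
    using X by (auto simp: free_product_def)
  have fin: "finite X"
    using X'(1) matroid.finite_ground[OF M] matroid.finite_ground[OF N]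
    by (meson finite_Un finite_insert finite_subset)
  have "a \<notin> J" using matroid.indep_subset_ground[OF N J(1)] a(1) disj by blast
  have "card (insert b X - J) \<le> card (insert b (X - J))" using fin by (intro card_mono) auto
  also have "\<dots> \<le> Suc (card (X - J))" by (rule card_insert_le_m1) auto
  also have "\<dots> = card (insert a X - J)" using fin a(2) \<open>a \<notin> J\<close> by (simp add: insert_Diff_if)
  finally have "card (insert b X - J) \<le> Max (card ` \<I>)" using J(3) by simp
  moreover have "insert b X \<inter> S \<in> \<I>"
    using matroid.indep_hereditary[OF M X'(2), of "insert b X \<inter> S"] b by blast
  ultimately show "insert b X \<in> free_product S \<I> T \<J>"
    using J b X'(1) \<open>a \<notin> J\<close> by (intro free_productI[of _ _ _ _ J]) auto
qed

lemma card_le_Max_indep: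
  assumes "matroid S \<I>" "X \<in> \<I>"
  shows "card X \<le> Max (card ` \<I>)"
proof -
  have "finite \<I>"
    using assms(1) matroid.finite_ground matroid.indep_subset_ground
    by (metis finite_Pow_iff finite_subset PowI subsetI)
  then show ?thesis using assms(2) by simp
qed

text \<open>The empty witness suffices inside \<open>S\<close>, since an independent set of
  \<open>\<I>\<close> never exceeds its rank.\<close>

lemma free_product_left_factor:
  assumes M: "matroid S \<I>" and N: "matroid T \<J>" and "X \<subseteq> S"
  shows "X \<in> free_product S \<I> T \<J> \<longleftrightarrow> X \<in> \<I>"
proof
  assume X: "X \<in> \<I>"
  then show "X \<in> free_product S \<I> T \<J>"
    using assms card_le_Max_indep[OF M X] matroid.indep_empty[OF N]
    by (intro free_productI[of _ _ _ _ "{}"]) (auto simp: Int_absorb2)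
qed (use assms in \<open>auto simp: free_product_def Int_absorb2\<close>)

text \<open>This is contraction by \<open>S\<close>, phrased through \<open>S\<close> and the free
  product alone so that isomorphisms preserving \<open>S\<close> transport it. A maximum
  \<open>B\<close> uses up the whole allowance outside the witness, which leaves \<open>Y\<close> as
  the only possible witness for \<open>B \<union> Y\<close>.\<close>

lemma free_product_right_factor:
  assumes M: "matroid S \<I>" and N: "matroid T \<J>" and disj: "S \<inter> T = {}" and Y: "Y \<subseteq> T"
  shows "Y \<in> \<J> \<longleftrightarrow> (\<exists>B\<subseteq>S. B \<union> Y \<in> free_product S \<I> T \<J> \<and>
    (\<forall>X\<subseteq>S. X \<in> free_product S \<I> T \<J> \<longrightarrow> card X \<le> card B))" (is "_ \<longleftrightarrow> ?R")
proof -
  have fin: "finite S" "finite T"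
    using matroid.finite_ground[OF M] matroid.finite_ground[OF N] by auto
  have ne: "finite (card ` \<I>)" "card ` \<I> \<noteq> {}"
    using M fin(1) matroid.indep_subset_ground[OF M] matroid.indep_empty[OF M]
    by (auto intro: finite_subset[of \<I> "Pow S"])
  obtain B0 where B0: "B0 \<in> \<I>" "card B0 = Max (card ` \<I>)"
    using Max_in[OF ne] by auto
  have B0S: "B0 \<subseteq> S" using matroid.indep_subset_ground[OF M B0(1)] .
  show ?thesis
  proof
    assume YJ: "Y \<in> \<J>"
    have "(B0 \<union> Y) \<inter> S = B0" using B0S Y disj by blast
    moreover have "B0 \<union> Y - Y = B0" using B0S Y disj by blast
    ultimately have "B0 \<union> Y \<in> free_product S \<I> T \<J>"
      using B0 B0S Y YJ by (intro free_productI[of _ _ _ _ Y]) auto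
    then show ?R
      using B0 B0S free_product_left_factor[OF M N] card_le_Max_indep[OF M] by metis
  next
    assume ?R
    \<comment> \<open>The maximality of \<open>B\<close> is tested against the basis
      \<open>B0\<close>.\<close>
    then obtain B J where B: "B \<subseteq> S" "card B0 \<le> card B"
      and J: "J \<in> \<J>" "J \<subseteq> B \<union> Y" "card (B \<union> Y - J) \<le> Max (card ` \<I>)"
      using B0(1) B0S free_product_left_factor[OF M N]
      by (auto simp: free_product_def)
    have "J \<subseteq> Y"
      using J(2) matroid.indep_subset_ground[OF N J(1)] B(1) disj by blast
    have "B \<union> Y - J = B"
    proof (rule sym, rule card_seteq)
      show "finite (B \<union> Y - J)" using B(1) Y fin by (auto intro: finite_subset)
      show "B \<subseteq> B \<union> Y - J" using B(1) Y \<open>J \<subseteq> Y\<close> disj by blast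
      show "card (B \<union> Y - J) \<le> card B" using J(3) B(2) B0(2) by simp
    qed
    then have "Y \<subseteq> J" using B(1) Y disj by blast
    then show "Y \<in> \<J>" using J(1) \<open>J \<subseteq> Y\<close> by simp
  qed
qed

section \<open>Automorphisms from exchangeable sets\<close>

lemma exchangeable_image:
  assumes f: "bij_betw f E F" and iso: "\<And>X. X \<subseteq> E \<Longrightarrow> X \<in> \<K> \<longleftrightarrow> f ` X \<in> \<L>"
    and sub: "\<And>X. X \<in> \<L> \<Longrightarrow> X \<subseteq> F" and "S \<subseteq> E" and S: "exchangeable S E \<K>"
  shows "exchangeable (f ` S) F \<L>"
  unfolding exchangeable_def
proof (intro allI impI)
  fix Y c d
  assume Y: "insert c Y \<in> \<L>" and c: "c \<in> f ` S" "c \<notin> Y" and d: "d \<in> F - f ` S"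
  have im: "f ` E = F" using f by (simp add: bij_betw_def)
  obtain a where a: "a \<in> S" "c = f a" using c by blast
  obtain b where b: "b \<in> E - S" "d = f b" using d im by blast
  obtain X where X: "X \<subseteq> E" "Y = f ` X" using sub[OF Y] im by (metis insert_subset subset_imageE)
  have "insert a X \<in> \<K>" using iso[of "insert a X"] Y a X \<open>S \<subseteq> E\<close> by auto
  moreover have "a \<notin> X" using a X c by blast
  ultimately have "insert b X \<in> \<K>" using S a b unfolding exchangeable_def by blast
  then show "insert d Y \<in> \<L>" using iso[of "insert b X"] b X by auto
qed

text \<open>Exchangeability of \<open>S\<close> replaces \<open>a\<close> by \<open>b\<close>, and
  that of \<open>U\<close> replaces \<open>b\<close> by \<open>a\<close>. Sets containing both or
  neither are fixed by the transposition.\<close>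

lemma transpose_automorphism:
  assumes S: "exchangeable S E \<L>" and U: "exchangeable U E \<L>" and "S \<subseteq> E" "U \<subseteq> E"
    and a: "a \<in> S - U" and b: "b \<in> U - S"
  shows "X \<in> \<L> \<longleftrightarrow> transpose a b ` X \<in> \<L>"
proof -
  have *: "insert a Z \<in> \<L> \<longleftrightarrow> insert b Z \<in> \<L>" if "a \<notin> Z" "b \<notin> Z" for Z
    using S U a b that \<open>S \<subseteq> E\<close> \<open>U \<subseteq> E\<close> unfolding exchangeable_def by blast
  have im: "transpose a b ` Z = Z" if "a \<notin> Z" "b \<notin> Z" for Z
    using that by (force simp: transpose_def image_iff)
  consider "a \<in> X \<longleftrightarrow> b \<in> X" | "a \<in> X" "b \<notin> X" | "a \<notin> X" "b \<in> X" by blast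
  then show ?thesis
  proof cases
    case 1
    then have "transpose a b ` X = X" by (rule transpose_image_eq)
    then show ?thesis by simp
  next
    case 2
    then have X: "X = insert a (X - {a})" by blast
    have "transpose a b ` insert a (X - {a}) = insert b (X - {a})"
      unfolding image_insert using 2 im[of "X - {a}"] by simp
    then have "transpose a b ` X = insert b (X - {a})" by (simp only: X[symmetric])
    then show ?thesis using *[of "X - {a}"] 2 X by auto
  next
    case 3
    then have X: "X = insert b (X - {b})" by blast
    have "transpose a b ` insert b (X - {b}) = insert a (X - {b})"
      unfolding image_insert using 3 im[of "X - {b}"] by simp
    then have "transpose a b ` X = insert a (X - {b})" by (simp only: X[symmetric])
    then show ?thesis using *[of "X - {b}"] 3 X by auto
  qed
qed

text \<open>Each transposition of some \<open>a\<close> in \<open>S - U\<close> with some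
  \<open>b\<close> in \<open>U - S\<close> brings \<open>S\<close> one element closer to
  \<open>U\<close>. Being an automorphism, it keeps the moved set exchangeable, so induction on
  \<open>card (S - U)\<close> applies.\<close>

lemma exchangeable_automorphism:
  assumes "finite E" and sub: "\<And>X. X \<in> \<L> \<Longrightarrow> X \<subseteq> E"
    and "U \<subseteq> E" and U: "exchangeable U E \<L>"
    and "S \<subseteq> E" "exchangeable S E \<L>" "card S = card U"
  shows "\<exists>f. bij_betw f E E \<and> f ` S = U \<and> (\<forall>X\<subseteq>E. X \<in> \<L> \<longleftrightarrow> f ` X \<in> \<L>)"
  using assms(5-7)
proof (induction "card (S - U)" arbitrary: S rule: less_induct)
  case less
  have fin: "finite S" "finite U" using \<open>finite E\<close> less.prems(1) \<open>U \<subseteq> E\<close> by (auto intro: finite_subset)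
  show ?case
  proof (cases "S = U")
    case True
    then show ?thesis by (intro exI[of _ "\<lambda>x. x"]) (auto simp: bij_betw_def)
  next
    case False
    obtain a where a: "a \<in> S - U"
      using False less.prems(3) fin card_subset_eq[of U S] by blast
    obtain b where b: "b \<in> U - S"
      using False less.prems(3) fin card_subset_eq[of S U] by fastforce
    let ?t = "transpose a b"
    have ab: "a \<in> E" "b \<in> E" using a b less.prems(1) \<open>U \<subseteq> E\<close> by auto
    have t: "bij_betw ?t E E"
      using ab by simp
    have auto_t: "X \<in> \<L> \<longleftrightarrow> ?t ` X \<in> \<L>" for X
      using transpose_automorphism[OF less.prems(2) U less.prems(1) \<open>U \<subseteq> E\<close> a b] .
    have "?t x = x" if "x \<in> S - {a}" for x
      using that b by (auto simp: transpose_def)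
    then have "?t ` (S - {a}) = S - {a}" by simp
    then have tS: "?t ` S = insert b (S - {a})"
      using a by (metis DiffD1 image_insert insert_Diff transpose_apply_first)
    have "?t ` S - U = (S - U) - {a}" unfolding tS using b by blast
    then have "card (?t ` S - U) < card (S - U)"
      using a fin by (metis card_Diff1_less finite_Diff)
    moreover have "?t ` S \<subseteq> E" unfolding tS using ab less.prems(1) by blast
    moreover have "exchangeable (?t ` S) E \<L>"
      using exchangeable_image[OF t auto_t sub less.prems(1,2)] .
    moreover have "card (?t ` S) = card U"
      using less.prems(3) by (simp add: card_image)
    ultimately obtain g where g: "bij_betw g E E" "g ` ?t ` S = U"
      "\<And>X. X \<subseteq> E \<Longrightarrow> X \<in> \<L> \<longleftrightarrow> g ` X \<in> \<L>"
      using less.hyps[of "?t ` S"] by blast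
    have "X \<in> \<L> \<longleftrightarrow> (g \<circ> ?t) ` X \<in> \<L>" if "X \<subseteq> E" for X
    proof -
      have "?t ` X \<subseteq> E" using that t by (auto simp: bij_betw_def)
      then show ?thesis using auto_t g(3) by (metis image_comp)
    qed
    moreover have "(g \<circ> ?t) ` S = U" using g(2) by (simp add: image_comp)
    ultimately show ?thesis using bij_betw_trans[OF t g(1)] by blast
  qed
qed

section \<open>Cancellation and counting\<close>

lemma free_product_cancel:
  assumes M1: "matroid S \<I>\<^sub>1" and N1: "matroid T \<J>\<^sub>1" and M2: "matroid S \<I>\<^sub>2" and N2: "matroid T \<J>\<^sub>2"
    and disj: "S \<inter> T = {}"
    and iso: "matroid_iso (S \<union> T) (free_product S \<I>\<^sub>1 T \<J>\<^sub>1) (S \<union> T) (free_product S \<I>\<^sub>2 T \<J>\<^sub>2)"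
  shows "matroid_iso S \<I>\<^sub>1 S \<I>\<^sub>2 \<and> matroid_iso T \<J>\<^sub>1 T \<J>\<^sub>2"
proof -
  let ?E = "S \<union> T" and ?K = "free_product S \<I>\<^sub>1 T \<J>\<^sub>1" and ?L = "free_product S \<I>\<^sub>2 T \<J>\<^sub>2"
  obtain f where f: "bij_betw f ?E ?E" and fi: "\<And>X. X \<subseteq> ?E \<Longrightarrow> X \<in> ?K \<longleftrightarrow> f ` X \<in> ?L"
    using iso unfolding matroid_iso_def by blast
  have inj_f: "inj_on f ?E" using f by (simp add: bij_betw_def)
  have fin: "finite ?E" and sub: "\<And>X. X \<in> ?L \<Longrightarrow> X \<subseteq> ?E"
    using matroid_free_product[OF M2 N2 disj]
    by (auto dest: matroid.finite_ground matroid.indep_subset_ground)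
  have ex: "exchangeable (f ` S) ?E ?L"
    using exchangeable_image[OF f fi sub _ exchangeable_free_product[OF M1 N1 disj]] by blast
  have fS: "f ` S \<subseteq> ?E" using f by (auto simp: bij_betw_def)
  have "card (f ` S) = card S" using inj_f by (auto intro: card_image inj_on_subset)
  then obtain g where g: "bij_betw g ?E ?E" "g ` f ` S = S"
    and gi: "\<And>X. X \<subseteq> ?E \<Longrightarrow> X \<in> ?L \<longleftrightarrow> g ` X \<in> ?L"
    using exchangeable_automorphism[OF fin sub _ exchangeable_free_product[OF M2 N2 disj] fS ex]
    by blast
  \<comment> \<open>The automorphism \<open>g\<close> corrects \<open>f\<close> so that the
    composite maps \<open>S\<close> to itself, hence also \<open>T\<close> to itself.\<close>
  define h where "h = g \<circ> f"
  have h: "bij_betw h ?E ?E" unfolding h_def using f g(1) by (rule bij_betw_trans)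
  have inj: "inj_on h ?E" using h by (simp add: bij_betw_def)
  have hS: "h ` S = S" using g(2) by (simp add: h_def image_comp)
  have hi: "X \<in> ?K \<longleftrightarrow> h ` X \<in> ?L" if "X \<subseteq> ?E" for X
  proof -
    have "f ` X \<subseteq> ?E" using f that by (auto simp: bij_betw_def)
    then show ?thesis using fi[OF that] gi by (simp add: h_def image_comp)
  qed
  have bS: "bij_betw h S S" using inj hS by (auto simp: bij_betw_def intro: inj_on_subset)
  have "h ` (?E - S) = ?E - S"
    using h hS inj inj_on_image_set_diff[OF inj, of ?E S] by (simp add: bij_betw_def)
  moreover have "?E - S = T" using disj by blast
  ultimately have hT: "h ` T = T" by simp
  then have bT: "bij_betw h T T" using inj by (auto simp: bij_betw_def intro: inj_on_subset)
  have "X \<in> \<I>\<^sub>1 \<longleftrightarrow> h ` X \<in> \<I>\<^sub>2" if "X \<subseteq> S" for X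
  proof -
    have "h ` X \<subseteq> S" using that hS by blast
    then show ?thesis
      using hi[of X] that free_product_left_factor[OF M1 N1] free_product_left_factor[OF M2 N2]
      by blast
  qed
  moreover have "Y \<in> \<J>\<^sub>1 \<longleftrightarrow> h ` Y \<in> \<J>\<^sub>2" if Y: "Y \<subseteq> T" for Y
  proof -
    have hY: "h ` Y \<subseteq> T" using Y hT by blast
    \<comment> \<open>As \<open>h\<close> permutes \<open>S\<close>, quantifiers over subsets of
      \<open>S\<close> can be reindexed along \<open>h\<close>.\<close>
    have all_S: "(\<forall>X\<subseteq>S. P X) \<longleftrightarrow> (\<forall>X\<subseteq>S. P (h ` X))"
      and ex_S: "(\<exists>X\<subseteq>S. P X) \<longleftrightarrow> (\<exists>X\<subseteq>S. P (h ` X))" for P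
      using hS by (metis image_mono subset_imageE)+
    have card: "card (h ` X) = card X" if "X \<subseteq> S" for X
      using that bS by (auto simp: bij_betw_def intro: card_image inj_on_subset)
    have indep: "h ` X \<in> ?L \<longleftrightarrow> X \<in> ?K" "h ` X \<union> h ` Y \<in> ?L \<longleftrightarrow> X \<union> Y \<in> ?K"
      if "X \<subseteq> S" for X
      using hi[of X] hi[of "X \<union> Y"] that Y by (auto simp: image_Un)
    have "h ` Y \<in> \<J>\<^sub>2 \<longleftrightarrow>
      (\<exists>B\<subseteq>S. h ` B \<union> h ` Y \<in> ?L \<and> (\<forall>X\<subseteq>S. h ` X \<in> ?L \<longrightarrow> card (h ` X) \<le> card (h ` B)))"
      unfolding free_product_right_factor[OF M2 N2 disj hY] by (subst ex_S, subst all_S) (rule refl)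
    also have "\<dots> \<longleftrightarrow> Y \<in> \<J>\<^sub>1"
      unfolding free_product_right_factor[OF M1 N1 disj Y]
      using card indep by (intro ex_cong1 conj_cong refl) auto
    finally show ?thesis by simp
  qed
  ultimately show ?thesis using bS bT unfolding matroid_iso_def by blast
qed

theorem corollary9:
  fixes n m :: nat
  shows "num_matroids (n + m) \<ge> num_matroids n * num_matroids m"
proof -
  let ?S = "{..<n}" and ?T = "{n..<n + m}"
  have disj: "?S \<inter> ?T = {}" and Un: "?S \<union> ?T = {..<n + m}" by auto
  \<comment> \<open>Fixing a representative of each class makes the free product a function on pairs
    of classes.\<close>
  define rep :: "nat set set set \<Rightarrow> nat set set" where "rep C = (SOME \<I>. \<I> \<in> C)" for C
  have rep: "matroid E (rep C)" "C = iso_rel E `` {rep C}"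
    if C: "C \<in> iso_classes_on E" for C and E :: "nat set"
  proof -
    obtain \<I> where I: "\<I> \<in> matroids_on E" "C = iso_rel E `` {\<I>}"
      using C unfolding iso_classes_on_def by (rule quotientE)
    have "rep C \<in> C"
      unfolding rep_def using I equiv_class_self[OF equiv_iso_rel I(1)] by (metis someI)
    then have r: "(\<I>, rep C) \<in> iso_rel E" using I by simp
    then show "matroid E (rep C)" by (simp add: iso_rel_def matroids_on_def)
    show "C = iso_rel E `` {rep C}" using I(2) equiv_class_eq[OF equiv_iso_rel r] by simp
  qed
  have same: "C = D"
    if "C \<in> iso_classes_on E" "D \<in> iso_classes_on E" "matroid_iso E (rep C) E (rep D)"
    for C D and E :: "nat set"
  proof -
    have "(rep C, rep D) \<in> iso_rel E"
      using that rep(1) by (simp add: iso_rel_def matroids_on_def)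
    then show ?thesis using rep(2) that equiv_class_eq[OF equiv_iso_rel] by metis
  qed
  let ?p = "\<lambda>(C, D). free_product ?S (rep C) ?T (rep D)"
  let ?h = "\<lambda>x. iso_rel {..<n + m} `` {?p x}"
  let ?A = "iso_classes_on ?S \<times> iso_classes_on ?T"
  have p: "?p x \<in> matroids_on {..<n + m}" if "x \<in> ?A" for x
    using that matroid_free_product[OF rep(1) rep(1) disj] Un
    by (auto simp: matroids_on_def)
  have "card ?A \<le> card (iso_classes_on {..<n + m})"
  proof (rule card_inj_on_le)
    show "inj_on ?h ?A"
    proof (rule inj_onI)
      fix x y assume x: "x \<in> ?A" and y: "y \<in> ?A" and eq: "?h x = ?h y"
      obtain C D C' D' where xy: "x = (C, D)" "y = (C', D')" by (metis surj_pair)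
      have "(?p x, ?p y) \<in> iso_rel {..<n + m}"
        using eq eq_equiv_class[OF _ equiv_iso_rel p[OF y]] by blast
      then have "matroid_iso (?S \<union> ?T) (?p x) (?S \<union> ?T) (?p y)"
        by (simp add: iso_rel_def Un)
      then have "matroid_iso ?S (rep C) ?S (rep C') \<and> matroid_iso ?T (rep D) ?T (rep D')"
        using x y xy rep(1) disj by (intro free_product_cancel) auto
      then show "x = y" using x y xy same by auto
    qed
    show "?h ` ?A \<subseteq> iso_classes_on {..<n + m}"
      using p unfolding iso_classes_on_def by (blast intro: quotientI)
  qed (simp add: finite_iso_classes_on)
  \<comment> \<open>The shifted ground set \<open>?T\<close>, chosen disjoint from
    \<open>?S\<close>, has size \<open>m\<close> and so carries \<open>num_matroids m\<close>
    classes.\<close>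
  then show ?thesis
    using card_iso_classes_on[of ?T] by (simp add: card_cartesian_product num_matroids_def)
qed

end
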